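(* Let $\mathcal{M}_{src}$ be the source MDP with transition model $P_{src}$ and let $\mathcal{M}_r$ be the target robust MDP with nominal model $P^o$ and total variation uncertainty set $\mathcal{U}^\sigma_{TV}(P^o)$; both share $\mathcal{S},\mathcal{A},\gamma,r,d_0$, and $|r(s,a)|\le r_{max}$ for all $(s,a)$. Let $\hat{P}^o$ be an estimated target model (a transition model on $\mathcal{S}\times\mathcal{A}$, estimated from an offline dataset of transitions sampled from $P^o$). For a policy $\pi$, let $P^{\pi,\mathcal{U}^\sigma_{TV}(P^o)}$ and $P^{\pi,\mathcal{U}^\sigma_{TV}(\hat{P}^o)}$ denote the worst-case models for $\pi$ with respect to $\mathcal{U}^\sigma_{TV}(P^o)$ and $\mathcal{U}^\sigma_{TV}(\hat{P}^o)$, respectively, let $V^{\pi,\sigma}$ and $V^{\pi,\sigma}_{\hat{P}^o}$ be the robust value functions of $\pi$ with respect to $\mathcal{U}^\sigma_{TV}(P^o)$ and $\mathcal{U}^\sigma_{TV}(\hat{P}^o)$, respectively, and let $V^{\pi,src}=V^{\pi,P_{src}}$. For $(s,a)\in\mathcal{S}\times\mathcal{A}$ define $$A(s,a) = D_{TV}\big(P^{\pi,\mathcal{U}^\sigma_{TV}(P^o)}(\cdot|s,a),\,P^{\pi,\mathcal{U}^\sigma_{TV}(\hat{P}^o)}(\cdot|s,a)\big),$$ $$B(s,a) = \Big|\mathbb{E}_{s'\sim P_{src}(\cdot|s,a)}[V^{\pi,\sigma}_{\hat{P}^o}(s')] - \inf_{P\in\mathcal{U}^\sigma_{TV}(\hat{P}^o)}\mathbb{E}_{s'\sim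 P(\cdot|s,a)}[V^{\pi,\sigma}_{\hat{P}^o}(s')]\Big|.$$ Then for every policy $\pi$, $$\mathbb{E}_{s\sim d_0}[V^{\pi,\sigma}(s)] \;\ge\; \mathbb{E}_{s\sim d_0}[V^{\pi,src}(s)] - \frac{2\gamma r_{max}}{(1-\gamma)^2}\,\mathbb{E}_{(s,a)\sim d^\pi_{\bar P}}\big[A(s,a)\big] - \frac{\gamma}{1-\gamma}\,\mathbb{E}_{(s,a)\sim d^\pi_{P_{src}}}\big[B(s,a)\big],$$ where $\bar P = P^{\pi,\mathcal{U}^\sigma_{TV}(\hat{P}^o)}$.
   Context: An MDP is $(\mathcal{S},\mathcal{A},\gamma,r,d_0,P)$ with state space $\mathcal{S}$, action space $\mathcal{A}$, discount $\gamma\in(0,1)$, reward $r:\mathcal{S}\times\mathcal{A}\to\mathbb{R}$, initial state distribution $d_0$, and transition model $P(\cdot|s,a)\in\Delta(\mathcal{S})$, where $\Delta(\mathcal{X})$ denotes the probability distributions on $\mathcal{X}$. A policy is a map $\pi:\mathcal{S}\to\Delta(\mathcal{A})$. Value function: $V^{\pi,P}(s)=\mathbb{E}_{\pi,P}[\sum_{t\ge0}\gamma^t r(s_t,a_t)\mid s_0=s]$. Discounted state-action occupancy: $d^\pi_P(s,a)=(1-\gamma)\,\mathbb{E}_{\pi,P}[\sum_{t\ge0}\gamma^t\mathbf{1}(s_t=s,a_t=a)]$ with $s_0\sim d_0$. Total variation distance: $D_{TV}(P,Q)=\tfrac12\int|dP-dQ|$, i.e. $\tfrac12\sum_{s'}|P(s')-Q(s')|$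 in the discrete case. Uncertainty set around a model $P'$ with radius $\sigma$: $\mathcal{U}^\sigma_{TV}(P')$ is the Cartesian product over $(s,a)\in\mathcal{S}\times\mathcal{A}$ of the sets $\{P(\cdot|s,a)\in\Delta(\mathcal{S}): D_{TV}(P(\cdot|s,a),P'(\cdot|s,a))\le\sigma\}$. Robust value function of $\pi$ with respect to $\mathcal{U}^\sigma_{TV}(P')$: $s\mapsto\inf_{P\in\mathcal{U}^\sigma_{TV}(P')}V^{\pi,P}(s)$. The worst-case model for $\pi$ with respect to $\mathcal{U}^\sigma_{TV}(P')$, written $P^{\pi,\mathcal{U}^\sigma_{TV}(P')}$, is an element of $\mathcal{U}^\sigma_{TV}(P')$ that attains this infimum at every state (its existence is implicit in the notation). The robust value function satisfies the robust Bellman equation, where the robust $Q$-function is $Q(s,a)=r(s,a)+\gamma\inf_{P\in\mathcal{U}^\sigma_{TV}(P')}\mathbb{E}_{s'\sim P(\cdot|s,a)}[V(s')]$ and $V$ is the robust value function. Standing assumption (fail-state): there is a state $s_f\in\mathcal{S}$ such that for all $a\in\mathcal{A}$ and all $P\in\mathcal{U}^\sigma_{TV}(P^o)$, $r(s_f,a)=0$ and $P(s_f|s_f,a)=1$. *)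

theory Defs
  imports "HOL-Probability.Probability"
begin

text \<open>
  States and actions range over arbitrary types; distributions on them are discrete, so that
  \<open>\<Delta>(X)\<close> is the type of probability mass functions on \<open>X\<close>. For bounded
  rewards and a discount in \<open>(0, 1)\<close> all integrals, series and infima below exist; the sums
  over states and actions converge absolutely.
\<close>

type_synonym ('s, 'a) policy = "'s \<Rightarrow> 'a pmf"
type_synonym ('s, 'a) model = "'s \<Rightarrow> 'a \<Rightarrow> 's pmf"

text \<open>
  The trajectory \<open>(s\<^sub>0, a\<^sub>0), (s\<^sub>1, a\<^sub>1), \<dots>\<close> with
  \<open>s\<^sub>0 \<sim> \<mu>\<close>, as a probability measure on sequences obtained from the
  Ionescu-Tulcea theorem.
\<close>

definition state_action :: "('s, 'a) policy \<Rightarrow> 's pmf \<Rightarrow> ('s \<times> 'a) pmf" where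
  "state_action \<pi> \<mu> = bind_pmf \<mu> (\<lambda>s. map_pmf (Pair s) (\<pi> s))"

definition step_kernel ::
  "'s pmf \<Rightarrow> ('s, 'a) policy \<Rightarrow> ('s, 'a) model \<Rightarrow> nat \<Rightarrow> (nat \<Rightarrow> 's \<times> 'a) \<Rightarrow> ('s \<times> 'a) measure"
where
  "step_kernel \<mu> \<pi> P t \<omega> =
     measure_pmf (state_action \<pi> (case t of 0 \<Rightarrow> \<mu> | Suc k \<Rightarrow> P (fst (\<omega> k)) (snd (\<omega> k))))"

interpretation trajectory:
  Ionescu_Tulcea "step_kernel \<mu> \<pi> P" "\<lambda>_. count_space UNIV"
  for \<mu> :: "'s pmf" and \<pi> :: "('s, 'a) policy" and P :: "('s, 'a) model"
proof (rule Ionescu_Tulcea.intro)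
  fix t
  show "step_kernel \<mu> \<pi> P t \<in>
      measurable (PiM {0..<t} (\<lambda>_. count_space UNIV)) (subprob_algebra (count_space UNIV))"
  proof (cases t)
    case 0
    have "step_kernel \<mu> \<pi> P t = (\<lambda>_. measure_pmf (state_action \<pi> \<mu>))"
      by (simp add: step_kernel_def 0 fun_eq_iff)
    then show ?thesis
      by (simp add: measure_pmf_in_subprob_algebra)
  next
    case (Suc k)
    have *: "(\<lambda>x. measure_pmf (state_action \<pi> (P (fst x) (snd x)))) \<in>
        measurable (count_space UNIV) (subprob_algebra (count_space UNIV))"
      by (auto intro: measure_pmf_in_subprob_algebra)
    have "(\<lambda>\<omega>. \<omega> k) \<in> measurable (PiM {0..<t} (\<lambda>_. count_space UNIV)) (count_space UNIV)"
      using Suc by (intro measurable_component_singleton) simp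
    moreover have "step_kernel \<mu> \<pi> P t =
        (\<lambda>\<omega>. measure_pmf (state_action \<pi> (P (fst (\<omega> k)) (snd (\<omega> k)))))"
      by (simp add: step_kernel_def Suc fun_eq_iff)
    ultimately show ?thesis
      using measurable_compose[OF _ *] by simp
  qed
next
  fix t \<omega>
  show "prob_space (step_kernel \<mu> \<pi> P t \<omega>)"
    by (simp add: step_kernel_def measure_pmf.prob_space_axioms)
qed

definition trajectory ::
  "'s pmf \<Rightarrow> ('s, 'a) policy \<Rightarrow> ('s, 'a) model \<Rightarrow> (nat \<Rightarrow> 's \<times> 'a) measure"
where
  "trajectory \<mu> \<pi> P = trajectory.PF.lim \<mu> \<pi> P"

definition V_fun ::
  "real \<Rightarrow> ('s \<Rightarrow> 'a \<Rightarrow> real) \<Rightarrow> ('s, 'a) policy \<Rightarrow> ('s, 'a) model \<Rightarrow> 's \<Rightarrow> real"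
where
  "V_fun \<gamma> r \<pi> P s =
     (\<integral>\<omega>. (\<Sum>t. \<gamma> ^ t * r (fst (\<omega> t)) (snd (\<omega> t))) \<partial>trajectory (return_pmf s) \<pi> P)"

definition occupancy ::
  "real \<Rightarrow> 's pmf \<Rightarrow> ('s, 'a) policy \<Rightarrow> ('s, 'a) model \<Rightarrow> 's \<Rightarrow> 'a \<Rightarrow> real"
where
  "occupancy \<gamma> d0 \<pi> P s a =
     (1 - \<gamma>) * (\<integral>\<omega>. (\<Sum>t. \<gamma> ^ t * of_bool (\<omega> t = (s, a))) \<partial>trajectory d0 \<pi> P)"

definition occ_expectation :: "('s \<Rightarrow> 'a \<Rightarrow> real) \<Rightarrow> ('s \<Rightarrow> 'a \<Rightarrow> real) \<Rightarrow> real" where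
  "occ_expectation d f = (\<Sum>\<^sub>\<infinity>(s, a)\<in>UNIV. d s a * f s a)"

definition tv_dist :: "'s pmf \<Rightarrow> 's pmf \<Rightarrow> real" where
  "tv_dist p q = 1 / 2 * (\<Sum>\<^sub>\<infinity>s\<in>UNIV. \<bar>pmf p s - pmf q s\<bar>)"

definition tv_ball :: "real \<Rightarrow> ('s, 'a) model \<Rightarrow> ('s, 'a) model set" where
  "tv_ball \<sigma> P' = {P. \<forall>s a. tv_dist (P s a) (P' s a) \<le> \<sigma>}"

definition robust_V ::
  "real \<Rightarrow> ('s \<Rightarrow> 'a \<Rightarrow> real) \<Rightarrow> ('s, 'a) policy \<Rightarrow> ('s, 'a) model set \<Rightarrow> 's \<Rightarrow> real"
where
  "robust_V \<gamma> r \<pi> U s = (INF P\<in>U. V_fun \<gamma> r \<pi> P s)"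

definition worst_case_model ::
  "real \<Rightarrow> ('s \<Rightarrow> 'a \<Rightarrow> real) \<Rightarrow> ('s, 'a) policy \<Rightarrow> ('s, 'a) model set \<Rightarrow> ('s, 'a) model \<Rightarrow> bool"
where
  "worst_case_model \<gamma> r \<pi> U P \<longleftrightarrow> P \<in> U \<and> (\<forall>s. V_fun \<gamma> r \<pi> P s = robust_V \<gamma> r \<pi> U s)"

definition fail_state :: "('s \<Rightarrow> 'a \<Rightarrow> real) \<Rightarrow> ('s, 'a) model \<Rightarrow> 's \<Rightarrow> bool" where
  "fail_state r P sf \<longleftrightarrow> (\<forall>a. r sf a = 0 \<and> pmf (P sf a) sf = 1)"

text \<open>
  A fail state of a robust MDP is meant to be one for every model in the uncertainty set. The
  full total variation ball also perturbs the transitions out of \<open>sf\<close>, so with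
  \<open>\<sigma> > 0\<close> and at least two states no such \<open>sf\<close> exists
  (\<open>fail_state_tv_ball_trivial\<close>). Requiring \<open>fail_state\<close> of the nominal
  model only is satisfiable and is implied by requiring it on the ball
  (\<open>fail_state_nominal\<close>).
\<close>

lemma fail_state_nominal:
  assumes "0 \<le> \<sigma>" and "\<forall>P\<in>tv_ball \<sigma> Po. fail_state r P sf"
  shows "fail_state r Po sf"
  using assms by (auto simp: tv_ball_def tv_dist_def)

lemma fail_state_tv_ball_trivial:
  fixes Po :: "('s, 'a) model"
  assumes "0 < \<sigma>" and fs: "\<forall>P\<in>tv_ball \<sigma> Po. fail_state r P sf"
  shows "(UNIV :: 's set) = {sf}"
proof (rule ccontr)
  assume "(UNIV :: 's set) \<noteq> {sf}"
  then obtain s' where s': "s' \<noteq> sf" by auto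
  define e where "e = min \<sigma> 1"
  have e: "0 < e" "e \<le> 1" "e \<le> \<sigma>" using \<open>0 < \<sigma>\<close> by (auto simp: e_def)
  define q where "q = bind_pmf (bernoulli_pmf e) (\<lambda>b. return_pmf (if b then s' else sf))"
  have q: "pmf q s = (if s = s' then e else if s = sf then 1 - e else 0)" for s
  proof -
    have "pmf q s = measure_pmf.expectation (bernoulli_pmf e)
        (\<lambda>b. pmf (return_pmf (if b then s' else sf)) s)"
      by (simp only: q_def pmf_bind)
    also have "\<dots> = (if s = s' then e else if s = sf then 1 - e else 0)"
      using e s' by (auto simp: indicator_def)
    finally show ?thesis .
  qed
  have "fail_state r Po sf"
    using fail_state_nominal[OF _ fs] \<open>0 < \<sigma>\<close> by simp
  then have one: "pmf (Po sf a) sf = 1" for a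
    by (simp add: fail_state_def)
  have Po: "pmf (Po sf a) s = of_bool (s = sf)" for a s
  proof (cases "s = sf")
    case False
    have "pmf (Po sf a) s + pmf (Po sf a) sf = measure_pmf.prob (Po sf a) {s, sf}"
      using False by (simp add: measure_measure_pmf_finite)
    also have "\<dots> \<le> 1"
      by simp
    finally show ?thesis
      using False one[of a] pmf_nonneg[of "Po sf a" s] by simp
  qed (simp add: one)
  define P where "P = Po(sf := \<lambda>_. q)"
  have "tv_dist q (Po sf a) = e" for a
  proof -
    have "(\<Sum>\<^sub>\<infinity>s\<in>UNIV. \<bar>pmf q s - pmf (Po sf a) s\<bar>) = (\<Sum>\<^sub>\<infinity>s\<in>{sf, s'}. \<bar>pmf q s - pmf (Po sf a) s\<bar>)"
      by (rule infsum_cong_neutral) (auto simp: q Po)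
    also have "\<dots> = 2 * e"
      using s' e by (simp add: q Po)
    finally show ?thesis by (simp add: tv_dist_def)
  qed
  then have "P \<in> tv_ball \<sigma> Po"
    using e \<open>0 < \<sigma>\<close> by (auto simp: tv_ball_def P_def tv_dist_def)
  then have "pmf q sf = 1"
    using fs by (auto simp: fail_state_def P_def)
  then show False
    using q[of sf] s' e by simp
qed

end

theory Submission
  imports Defs
begin

text \<open>
  Sampling a trajectory at an independent geometric time with parameter \<open>1 - \<gamma>\<close> gives a
  pair distributed according to the discounted occupancy. Splitting off the time zero turns the
  Bellman and flow equations into identities between probability mass functions, which combine to
  \<open>(1 - \<gamma>) E\<^sub>\<mu>[V\<^sup>P - V\<^sup>Q] = \<gamma> E\<^sub>d[E\<^sub>P V\<^sup>P - E\<^sub>Q V\<^sup>P]\<close>, where \<open>d\<close> is the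
  occupancy under \<open>Q\<close> started from \<open>\<mu>\<close>. For the two worst-case models the integrand is bounded
  by total variation. For the worst-case model of the estimated set and the source it is at least
  \<open>- B\<close>, because that model lies in the set over which the infimum is taken.
\<close>

subsection \<open>Expectations under probability mass functions\<close>

lemma integrable_measure_pmf_bounded:
  fixes f :: "'x \<Rightarrow> real"
  assumes "\<And>x. \<bar>f x\<bar> \<le> K"
  shows "integrable (measure_pmf p) f"
  using assms by (intro measure_pmf.integrable_const_bound[where B=K]) auto

lemma abs_expectation_pmf_le:
  fixes f :: "'x \<Rightarrow> real"
  assumes "\<And>x. \<bar>f x\<bar> \<le> K"
  shows "\<bar>measure_pmf.expectation p f\<bar> \<le> K"
proof -
  have "\<bar>measure_pmf.expectation p f\<bar> \<le> measure_pmf.expectation p (\<lambda>x. \<bar>f x\<bar>)"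
    by (rule integral_abs_bound)
  also have "\<dots> \<le> measure_pmf.expectation p (\<lambda>_. K)"
    using assms by (intro integral_mono integrable_measure_pmf_bounded[where f="\<lambda>x. \<bar>f x\<bar>" and K=K]) auto
  finally show ?thesis by simp
qed

lemma expectation_bind_pmf:
  fixes f :: "'y \<Rightarrow> real"
  assumes "\<And>y. \<bar>f y\<bar> \<le> K"
  shows "measure_pmf.expectation (bind_pmf p N) f
    = measure_pmf.expectation p (\<lambda>x. measure_pmf.expectation (N x) f)"
  unfolding measure_pmf_bind
  using assms
  by (intro integral_bind[where K="count_space UNIV" and B=K and B'=1])
     (auto simp: measure_pmf_in_subprob_algebra measure_pmf.finite_measure_axioms)

text \<open>The pmf is a density with respect to counting measure. The result is an ordered series,
  the form needed to match the discounted sum over time; \<open>has_sum_expectation_pmf\<close> is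
  the unordered analogue for sums over states and actions.\<close>

lemma expectation_pmf_sums_nat:
  fixes g :: "nat \<Rightarrow> real"
  assumes "\<And>n. \<bar>g n\<bar> \<le> K"
  shows "(\<lambda>n. pmf p n * g n) sums measure_pmf.expectation p g"
proof -
  have "integrable (measure_pmf p) g"
    using assms by (rule integrable_measure_pmf_bounded)
  then have "integrable (count_space UNIV) (\<lambda>n. pmf p n * g n)"
    unfolding measure_pmf_eq_density by (subst (asm) integrable_density) auto
  moreover have "measure_pmf.expectation p g = (\<integral>n. pmf p n * g n \<partial>count_space UNIV)"
    unfolding measure_pmf_eq_density by (subst integral_density) auto
  ultimately show ?thesis
    using sums_integral_count_space_nat by metis
qed

lemma has_sum_expectation_pmf:
  fixes f :: "'x \<Rightarrow> real"
  assumes "\<And>x. \<bar>f x\<bar> \<le> K"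
  shows "((\<lambda>x. pmf p x * f x) has_sum measure_pmf.expectation p f) UNIV"
proof -
  have "integrable (measure_pmf p) f"
    using assms by (rule integrable_measure_pmf_bounded)
  then have *: "Infinite_Set_Sum.abs_summable_on (\<lambda>x. pmf p x * f x) UNIV"
    unfolding measure_pmf_eq_density Infinite_Set_Sum.abs_summable_on_def
    by (subst (asm) integrable_density) auto
  then have "(\<lambda>x. pmf p x * f x) summable_on UNIV"
    unfolding abs_summable_equivalent[symmetric] by (rule abs_summable_summable)
  moreover have "measure_pmf.expectation p f = infsetsum (\<lambda>x. pmf p x * f x) UNIV"
    unfolding measure_pmf_eq_density infsetsum_def by (subst integral_density) auto
  then have "measure_pmf.expectation p f = infsum (\<lambda>x. pmf p x * f x) UNIV"
    using infsetsum_infsum[OF *] by simp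
  ultimately show ?thesis
    by simp
qed

lemma summable_on_abs_pmf_diff:
  "(\<lambda>x. \<bar>pmf p x - pmf q x\<bar>) summable_on UNIV"
proof -
  have "(\<lambda>x. pmf p x * 1 + pmf q x * 1) summable_on UNIV"
    by (intro summable_on_add has_sum_imp_summable[OF has_sum_expectation_pmf]) auto
  then show ?thesis
    by (rule summable_on_comparison_test) (auto simp: abs_diff_le_iff intro: order_trans[OF abs_triangle_ineq4])
qed

lemma tv_dist_nonneg: "0 \<le> tv_dist p q"
  unfolding tv_dist_def by (auto intro: infsum_nonneg)

text \<open>The differences are dominated termwise by \<open>pmf p + pmf q\<close>, whose total is
  2. This makes the model discrepancy \<open>A\<close> a bounded integrand.\<close>

lemma tv_dist_le_1: "tv_dist p q \<le> 1"
proof -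
  have 1: "(pmf p has_sum 1) UNIV" for p :: "'a pmf"
    using has_sum_expectation_pmf[of "\<lambda>_. 1" 1 p] by simp
  have "(\<Sum>\<^sub>\<infinity>x. \<bar>pmf p x - pmf q x\<bar>) \<le> 1 + 1"
    by (rule has_sum_mono[OF has_sum_infsum[OF summable_on_abs_pmf_diff] has_sum_add[OF 1 1]])
       (use abs_triangle_ineq4[of "pmf p _" "pmf q _"] in auto)
  then show ?thesis by (simp add: tv_dist_def)
qed

text \<open>Pair \<open>f\<close> with the signed mass \<open>pmf p - pmf q\<close> and bound each
  term by \<open>K\<close> times its absolute value. The factor 2 cancels the 1/2 in
  \<open>tv_dist\<close>.\<close>

lemma expectation_diff_le_tv_dist:
  fixes f :: "'x \<Rightarrow> real"
  assumes "\<And>x. \<bar>f x\<bar> \<le> K"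
  shows "\<bar>measure_pmf.expectation p f - measure_pmf.expectation q f\<bar> \<le> 2 * K * tv_dist p q"
proof -
  have s: "((\<lambda>x. (pmf p x - pmf q x) * f x) has_sum
      (measure_pmf.expectation p f - measure_pmf.expectation q f)) UNIV"
  proof -
    have "((\<lambda>x. pmf p x * f x + - (pmf q x * f x)) has_sum
        (measure_pmf.expectation p f + - measure_pmf.expectation q f)) UNIV"
      by (intro has_sum_add has_sum_uminusI has_sum_expectation_pmf[OF assms])
    then show ?thesis
      by (simp add: left_diff_distrib)
  qed
  have t: "((\<lambda>x. \<bar>pmf p x - pmf q x\<bar> * K) has_sum ((\<Sum>\<^sub>\<infinity>x. \<bar>pmf p x - pmf q x\<bar>) * K)) UNIV"
    by (intro has_sum_cmult_left has_sum_infsum summable_on_abs_pmf_diff)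
  have *: "\<bar>(pmf p x - pmf q x) * f x\<bar> \<le> \<bar>pmf p x - pmf q x\<bar> * K" for x
    unfolding abs_mult by (intro mult_left_mono assms) auto
  have "measure_pmf.expectation p f - measure_pmf.expectation q f \<le> (\<Sum>\<^sub>\<infinity>x. \<bar>pmf p x - pmf q x\<bar>) * K"
    by (rule has_sum_mono[OF s t]) (use * abs_le_D1 in blast)
  moreover have "- (measure_pmf.expectation p f - measure_pmf.expectation q f)
      \<le> (\<Sum>\<^sub>\<infinity>x. \<bar>pmf p x - pmf q x\<bar>) * K"
    by (rule has_sum_mono[OF has_sum_uminusI[OF s] t]) (use * abs_le_D2 in blast)
  ultimately show ?thesis by (simp add: tv_dist_def abs_le_iff mult.commute)
qed

subsection \<open>Marginals of the trajectory\<close>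

text \<open>The state process is a Markov chain; this is its transition operator on laws, so the
  t-fold iterate applied to \<mu> is the law of the state at time t.\<close>

definition state_step :: "('s, 'a) policy \<Rightarrow> ('s, 'a) model \<Rightarrow> 's pmf \<Rightarrow> 's pmf" where
  "state_step \<pi> P \<mu> = bind_pmf (state_action \<pi> \<mu>) (\<lambda>(s, a). P s a)"

lemma state_action_bind: "state_action \<pi> (bind_pmf p N) = bind_pmf p (\<lambda>x. state_action \<pi> (N x))"
  by (simp add: state_action_def bind_assoc_pmf)

lemma state_step_bind: "state_step \<pi> P (bind_pmf p N) = bind_pmf p (\<lambda>x. state_step \<pi> P (N x))"
  by (simp add: state_step_def state_action_bind bind_assoc_pmf)

lemma state_step_funpow_bind:
  "(state_step \<pi> P ^^ t) (bind_pmf p N) = bind_pmf p (\<lambda>x. (state_step \<pi> P ^^ t) (N x))"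
  by (induction t) (simp_all add: state_step_bind)

lemma sets_trajectory [measurable_cong]:
  "sets (trajectory \<mu> \<pi> P) = sets (PiM UNIV (\<lambda>_. count_space UNIV))"
  by (simp add: trajectory_def)

lemma measurable_trajectory_component [measurable]:
  "(\<lambda>\<omega>. \<omega> t) \<in> measurable (trajectory \<mu> \<pi> P) (count_space UNIV)"
  by measurable

text \<open>The Ionescu-Tulcea limit agrees with its finite-horizon laws on finitely many
  coordinates. The last coordinate of such a law is drawn from the kernel, which sees only the
  preceding pair, so induction on time applies.\<close>

lemma trajectory_marginal:
  "distr (trajectory \<mu> \<pi> P) (count_space UNIV) (\<lambda>\<omega>. \<omega> t)
    = measure_pmf (state_action \<pi> ((state_step \<pi> P ^^ t) \<mu>))"
proof -
  let ?M = "\<lambda>_::nat. count_space (UNIV :: ('a \<times> 'b) set)"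
  \<comment> \<open>\<open>C n\<close> is the joint law of the pairs at times 0 to n - 1, so time t
    first occurs in \<open>C (Suc t)\<close>. The constant \<open>undefined\<close> function is the
    unique history over the empty index set.\<close>
  define C where "C n = trajectory.C \<mu> \<pi> P 0 n (\<lambda>_. undefined)" for n
  have C_Suc: "C (Suc n) = C n \<bind> trajectory.eP \<mu> \<pi> P n" for n
    by (simp add: C_def)
  have u: "(\<lambda>_. undefined) \<in> space (PiM {0..<0} ?M)"
    by (simp add: space_PiM)
  have sC [measurable_cong]: "sets (C n) = sets (PiM {0..<n} ?M)" for n
    using trajectory.sets_C[OF u] by (simp add: C_def)
  have neC: "space (C n) \<noteq> {}" for n
    unfolding C_def using trajectory.prob_space_C[OF u] by (rule prob_space.not_empty)
  have restr: "distr (trajectory \<mu> \<pi> P) (count_space UNIV) (\<lambda>\<omega>. \<omega> t)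
      = distr (C (Suc t)) (count_space UNIV) (\<lambda>\<omega>. \<omega> t)" for t
  proof -
    have up: "trajectory.up_to {t} = Suc t"
      unfolding trajectory.up_to_def
      by (rule Least_equality) (auto, metis not_less_eq_eq)
    have "distr (trajectory \<mu> \<pi> P) (count_space UNIV) (\<lambda>\<omega>. \<omega> t)
        = distr (distr (trajectory \<mu> \<pi> P) (PiM {t} ?M) (\<lambda>x. restrict x {t})) (count_space UNIV) (\<lambda>\<omega>. \<omega> t)"
      by (subst distr_distr) (auto simp: comp_def)
    also have "\<dots> = distr (distr (C (Suc t)) (PiM {t} ?M) (\<lambda>x. restrict x {t})) (count_space UNIV) (\<lambda>\<omega>. \<omega> t)"
      using trajectory.distr_lim[of "{t}" \<mu> \<pi> P] by (simp add: trajectory_def trajectory.CI_def up C_def)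
    also have "\<dots> = distr (C (Suc t)) (count_space UNIV) (\<lambda>\<omega>. \<omega> t)"
    proof -
      have "(\<lambda>x. restrict x {t}) \<in> measurable (C (Suc t)) (PiM {t} ?M)"
        by (subst measurable_cong_sets[OF sC refl]) (auto intro!: measurable_restrict_subset)
      then show ?thesis
        by (subst distr_distr) (auto simp: comp_def)
    qed
    finally show ?thesis .
  qed
  \<comment> \<open>\<open>eP\<close> draws a pair from the kernel and writes it at index t by
    \<open>fun_upd\<close>; projecting to index t recovers the drawn pair.\<close>
  have step: "distr (C (Suc t)) (count_space UNIV) (\<lambda>\<omega>. \<omega> t) = C t \<bind> step_kernel \<mu> \<pi> P t" for t
  proof -
    have "distr (C (Suc t)) (count_space UNIV) (\<lambda>\<omega>. \<omega> t)
        = C t \<bind> (\<lambda>\<omega>. distr (trajectory.eP \<mu> \<pi> P t \<omega>) (count_space UNIV) (\<lambda>\<omega>. \<omega> t))"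
      using trajectory.measurable_eP[of \<mu> \<pi> P t] neC[of t]
      unfolding C_Suc by (subst distr_bind[where K="PiM {0..<Suc t} ?M"]) (auto cong: measurable_cong_sets)
    also have "\<dots> = C t \<bind> step_kernel \<mu> \<pi> P t"
    proof (rule bind_cong[OF refl])
      fix \<omega> assume "\<omega> \<in> space (C t)"
      then have w: "\<omega> \<in> space (PiM {0..<t} ?M)"
        using sets_eq_imp_space_eq[OF sC[of t]] by simp
      have "fun_upd \<omega> t \<in> measurable (step_kernel \<mu> \<pi> P t \<omega>) (PiM {0..<Suc t} ?M)"
        using w by (intro measurable_fun_upd[where J="{0..<t}"]) (auto simp: step_kernel_def)
      then show "distr (trajectory.eP \<mu> \<pi> P t \<omega>) (count_space UNIV) (\<lambda>\<omega>. \<omega> t) = step_kernel \<mu> \<pi> P t \<omega>"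
        unfolding trajectory.eP_def
        by (subst distr_distr) (auto simp: comp_def step_kernel_def intro!: distr_id2)
    qed
    finally show ?thesis .
  qed
  show ?thesis
  proof (induction t)
    case 0
    \<comment> \<open>\<open>C 0\<close> is the point mass at the empty history, which the kernel at
      time 0 ignores.\<close>
    have "C 0 \<bind> step_kernel \<mu> \<pi> P 0 = step_kernel \<mu> \<pi> P 0 (\<lambda>_. undefined)"
      using trajectory.P[of \<mu> \<pi> P 0] u by (simp add: C_def bind_return[where N="count_space UNIV"])
    then show ?case
      unfolding restr step by (simp add: step_kernel_def)
  next
    case (Suc t)
    let ?k = "\<lambda>x. measure_pmf (state_action \<pi> (P (fst x) (snd x)))"
    \<comment> \<open>Markov property: the kernel factors through coordinate t, so the history can
      be replaced by its marginal there, which the induction hypothesis identifies.\<close>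
    have "C (Suc t) \<bind> step_kernel \<mu> \<pi> P (Suc t) = C (Suc t) \<bind> (\<lambda>\<omega>. ?k (\<omega> t))"
      by (simp add: step_kernel_def[abs_def])
    also have "\<dots> = distr (C (Suc t)) (count_space UNIV) (\<lambda>\<omega>. \<omega> t) \<bind> ?k"
      using neC[of "Suc t"] measurable_component_singleton[of t "{0..<Suc t}" ?M]
      unfolding measurable_cong_sets[OF sC[of "Suc t", symmetric] refl]
      by (subst bind_distr[where K="count_space UNIV"])
         (auto simp: measure_pmf_in_subprob_algebra)
    also have "\<dots> = measure_pmf (state_action \<pi> ((state_step \<pi> P ^^ t) \<mu>)) \<bind> ?k"
      using Suc.IH unfolding restr by simp
    also have "\<dots> = measure_pmf (state_action \<pi> ((state_step \<pi> P ^^ Suc t) \<mu>))"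
      by (simp add: measure_pmf_bind[symmetric] state_step_def state_action_bind split_beta)
    finally show ?case
      unfolding restr step .
  qed
qed

lemma prob_space_trajectory: "prob_space (trajectory \<mu> \<pi> P)"
  by (rule prob_space_distrD[of "\<lambda>\<omega>. \<omega> 0" _ "count_space UNIV"])
     (simp_all add: trajectory_marginal measure_pmf.prob_space_axioms)

subsection \<open>The discounted occupancy as a probability mass function\<close>

text \<open>\<open>geometric_pmf (1 - \<gamma>)\<close> counts from 0 and gives t the mass
  \<open>(1 - \<gamma>) * \<gamma> ^ t\<close>, exactly the normalised discount weight.\<close>

definition discounted_state ::
  "real \<Rightarrow> ('s, 'a) policy \<Rightarrow> ('s, 'a) model \<Rightarrow> 's pmf \<Rightarrow> 's pmf"
where
  "discounted_state \<gamma> \<pi> P \<mu> = bind_pmf (geometric_pmf (1 - \<gamma>)) (\<lambda>t. (state_step \<pi> P ^^ t) \<mu>)"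

definition occupancy_pmf ::
  "real \<Rightarrow> ('s, 'a) policy \<Rightarrow> ('s, 'a) model \<Rightarrow> 's pmf \<Rightarrow> ('s \<times> 'a) pmf"
where
  "occupancy_pmf \<gamma> \<pi> P \<mu> = state_action \<pi> (discounted_state \<gamma> \<pi> P \<mu>)"

locale discount =
  fixes \<gamma> :: real
  assumes \<gamma>_pos: "0 < \<gamma>" and \<gamma>_less_1: "\<gamma> < 1"
begin

text \<open>Domination by \<open>\<gamma> ^ t * K\<close> allows exchanging series and integral;
  each term then depends only on a marginal, and the weights are geometric. Taking \<open>f\<close>
  to be the reward yields the value function, taking an indicator yields the occupancy.\<close>

lemma discounted_trajectory_expectation:
  fixes f :: "'s \<times> 'a \<Rightarrow> real"
  assumes bd: "\<And>x. \<bar>f x\<bar> \<le> K"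
  shows "(1 - \<gamma>) * (\<integral>\<omega>. (\<Sum>t. \<gamma> ^ t * f (\<omega> t)) \<partial>trajectory \<mu> \<pi> P)
    = measure_pmf.expectation (occupancy_pmf \<gamma> \<pi> P \<mu>) f"
proof -
  let ?T = "trajectory \<mu> \<pi> P"
  let ?E = "\<lambda>t. measure_pmf.expectation (state_action \<pi> ((state_step \<pi> P ^^ t) \<mu>)) f"
  interpret T: prob_space ?T by (rule prob_space_trajectory)
  have K: "0 \<le> K" using bd[of undefined] by linarith
  have geo: "summable (\<lambda>t. \<gamma> ^ t * K)"
    using \<gamma>_pos \<gamma>_less_1 by (intro summable_mult2 summable_geometric) auto
  have le: "\<bar>\<gamma> ^ t * f x\<bar> \<le> \<gamma> ^ t * K" for t x
    using \<gamma>_pos bd by (simp add: abs_mult mult_left_mono)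
  have [measurable]: "(\<lambda>\<omega>. f (\<omega> t)) \<in> borel_measurable ?T" for t
    by (rule measurable_compose[OF measurable_trajectory_component]) simp
  have int: "integrable ?T (\<lambda>\<omega>. \<gamma> ^ t * f (\<omega> t))" for t
    using le by (intro T.integrable_const_bound[where B="\<gamma> ^ t * K"]) auto
  have marg: "(\<integral>\<omega>. f (\<omega> t) \<partial>?T) = ?E t" for t
    by (subst trajectory_marginal[symmetric], subst integral_distr) auto
  have "(\<lambda>t. \<integral>\<omega>. \<gamma> ^ t * f (\<omega> t) \<partial>?T) sums (\<integral>\<omega>. (\<Sum>t. \<gamma> ^ t * f (\<omega> t)) \<partial>?T)"
  proof (rule sums_integral[OF int])
    show "AE \<omega> in ?T. summable (\<lambda>t. norm (\<gamma> ^ t * f (\<omega> t)))"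
      using le by (intro AE_I2 summable_comparison_test'[OF geo, of 0]) auto
    show "summable (\<lambda>t. \<integral>\<omega>. norm (\<gamma> ^ t * f (\<omega> t)) \<partial>?T)"
    proof (rule summable_comparison_test'[OF geo, of 0])
      fix t
      have "(\<integral>\<omega>. norm (\<gamma> ^ t * f (\<omega> t)) \<partial>?T) \<le> (\<integral>\<omega>. \<gamma> ^ t * K \<partial>?T)"
        using le by (intro integral_mono integrable_norm int) auto
      then show "norm (\<integral>\<omega>. norm (\<gamma> ^ t * f (\<omega> t)) \<partial>?T) \<le> \<gamma> ^ t * K"
        by (simp add: T.prob_space)
    qed
  qed
  then have "(\<lambda>t. (1 - \<gamma>) * (\<gamma> ^ t * ?E t)) sums ((1 - \<gamma>) * (\<integral>\<omega>. (\<Sum>t. \<gamma> ^ t * f (\<omega> t)) \<partial>?T))"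
    by (intro sums_mult) (simp add: marg)
  moreover have "(\<lambda>t. pmf (geometric_pmf (1 - \<gamma>)) t * ?E t) sums
      measure_pmf.expectation (geometric_pmf (1 - \<gamma>)) ?E"
    by (rule expectation_pmf_sums_nat[where K=K]) (rule abs_expectation_pmf_le[OF bd])
  then have "(\<lambda>t. (1 - \<gamma>) * (\<gamma> ^ t * ?E t)) sums measure_pmf.expectation (geometric_pmf (1 - \<gamma>)) ?E"
    using \<gamma>_pos \<gamma>_less_1 by (simp add: mult_ac)
  ultimately have "(1 - \<gamma>) * (\<integral>\<omega>. (\<Sum>t. \<gamma> ^ t * f (\<omega> t)) \<partial>?T)
      = measure_pmf.expectation (geometric_pmf (1 - \<gamma>)) ?E"
    by (rule sums_unique2)
  then show ?thesis
    by (simp add: occupancy_pmf_def discounted_state_def state_action_bind expectation_bind_pmf[OF bd])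
qed

lemma occupancy_eq_pmf: "occupancy \<gamma> d0 \<pi> P s a = pmf (occupancy_pmf \<gamma> \<pi> P d0) (s, a)"
proof -
  have "occupancy \<gamma> d0 \<pi> P s a
      = measure_pmf.expectation (occupancy_pmf \<gamma> \<pi> P d0) (\<lambda>x. of_bool (x = (s, a)))"
    unfolding occupancy_def by (rule discounted_trajectory_expectation[where K=1]) auto
  also have "(\<lambda>x. of_bool (x = (s, a)) :: real) = indicator {(s, a)}"
    by (auto simp: indicator_def)
  finally show ?thesis by (simp add: measure_pmf_single)
qed

lemma occ_expectation_eq:
  fixes f :: "'s \<Rightarrow> 'a \<Rightarrow> real"
  assumes "\<And>s a. \<bar>f s a\<bar> \<le> K"
  shows "occ_expectation (occupancy \<gamma> d0 \<pi> P) f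
    = measure_pmf.expectation (occupancy_pmf \<gamma> \<pi> P d0) (\<lambda>(s, a). f s a)"
proof -
  have "((\<lambda>x. pmf (occupancy_pmf \<gamma> \<pi> P d0) x * (\<lambda>(s, a). f s a) x) has_sum
      measure_pmf.expectation (occupancy_pmf \<gamma> \<pi> P d0) (\<lambda>(s, a). f s a)) UNIV"
    using assms by (intro has_sum_expectation_pmf[where K=K]) auto
  then show ?thesis
    unfolding occ_expectation_def occupancy_eq_pmf
    by (intro infsumI) (simp add: case_prod_unfold)
qed

text \<open>The random time and the random start are independent, so they may be sampled in either
  order.\<close>

lemma discounted_state_bind:
  "discounted_state \<gamma> \<pi> P (bind_pmf p N) = bind_pmf p (\<lambda>x. discounted_state \<gamma> \<pi> P (N x))"
  unfolding discounted_state_def state_step_funpow_bind by (rule bind_commute_pmf)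

lemma state_step_discounted_state:
  "state_step \<pi> P (discounted_state \<gamma> \<pi> P \<mu>) = discounted_state \<gamma> \<pi> P (state_step \<pi> P \<mu>)"
  by (simp add: discounted_state_def state_step_bind funpow_swap1)

text \<open>A geometric time is 0 with probability \<open>1 - \<gamma>\<close> and otherwise one
  more than a fresh geometric time, which leaves the chain to run from its law after one step. Both
  the Bellman and the flow equation come from this identity.\<close>

lemma discounted_state_unfold:
  "discounted_state \<gamma> \<pi> P \<mu> = bind_pmf (bernoulli_pmf (1 - \<gamma>))
     (\<lambda>b. if b then \<mu> else discounted_state \<gamma> \<pi> P (state_step \<pi> P \<mu>))"
proof -
  have "geometric_pmf (1 - \<gamma>) = bind_pmf (bernoulli_pmf (1 - \<gamma>))
      (\<lambda>b. if b then return_pmf 0 else map_pmf Suc (geometric_pmf (1 - \<gamma>)))"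
    using \<gamma>_pos \<gamma>_less_1 by (intro geometric_bind_pmf_unfold) auto
  then have "discounted_state \<gamma> \<pi> P \<mu> = bind_pmf (bind_pmf (bernoulli_pmf (1 - \<gamma>))
      (\<lambda>b. if b then return_pmf 0 else map_pmf Suc (geometric_pmf (1 - \<gamma>))))
      (\<lambda>t. (state_step \<pi> P ^^ t) \<mu>)"
    unfolding discounted_state_def by (rule arg_cong)
  also have "\<dots> = bind_pmf (bernoulli_pmf (1 - \<gamma>))
     (\<lambda>b. if b then \<mu> else discounted_state \<gamma> \<pi> P (state_step \<pi> P \<mu>))"
    by (auto simp: bind_assoc_pmf discounted_state_def bind_return_pmf bind_map_pmf funpow_swap1
        intro!: bind_pmf_cong)
  finally show ?thesis .
qed

lemma expectation_discounted_state_unfold: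
  fixes f :: "'s \<Rightarrow> real"
  assumes "\<And>x. \<bar>f x\<bar> \<le> K"
  shows "measure_pmf.expectation (discounted_state \<gamma> \<pi> P \<mu>) f
    = (1 - \<gamma>) * measure_pmf.expectation \<mu> f
      + \<gamma> * measure_pmf.expectation (discounted_state \<gamma> \<pi> P (state_step \<pi> P \<mu>)) f"
  by (subst discounted_state_unfold, subst expectation_bind_pmf[OF assms])
     (use \<gamma>_pos \<gamma>_less_1 in simp_all)

end

lemma expectation_state_action:
  fixes f :: "'s \<times> 'a \<Rightarrow> real"
  assumes "\<And>x. \<bar>f x\<bar> \<le> K"
  shows "measure_pmf.expectation (state_action \<pi> \<mu>) f
    = measure_pmf.expectation \<mu> (\<lambda>s. measure_pmf.expectation (\<pi> s) (\<lambda>a. f (s, a)))"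
  by (simp add: state_action_def expectation_bind_pmf[OF assms])

subsection \<open>Bellman equation and simulation lemma\<close>

locale bounded_reward = discount +
  fixes r :: "'s \<Rightarrow> 'a \<Rightarrow> real" and rmax :: real and \<pi> :: "('s, 'a) policy"
  assumes reward_bound: "\<And>s a. \<bar>r s a\<bar> \<le> rmax"
begin

abbreviation V :: "('s, 'a) model \<Rightarrow> 's \<Rightarrow> real" where
  "V \<equiv> V_fun \<gamma> r \<pi>"

abbreviation mean_reward :: "'s \<Rightarrow> real" where
  "mean_reward s \<equiv> measure_pmf.expectation (\<pi> s) (r s)"

lemma mean_reward_bound: "\<bar>mean_reward s\<bar> \<le> rmax"
  by (rule abs_expectation_pmf_le) (rule reward_bound)

text \<open>Rewards are averaged over the occupancy started at a point mass; integrating out the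
  action leaves a function of the state alone.\<close>

lemma V_eq: "(1 - \<gamma>) * V P s
    = measure_pmf.expectation (discounted_state \<gamma> \<pi> P (return_pmf s)) mean_reward"
proof -
  have "(1 - \<gamma>) * V P s
      = measure_pmf.expectation (occupancy_pmf \<gamma> \<pi> P (return_pmf s)) (\<lambda>x. r (fst x) (snd x))"
    unfolding V_fun_def
    by (rule discounted_trajectory_expectation[where K=rmax]) (rule reward_bound)
  then show ?thesis
    unfolding occupancy_pmf_def
    by (simp add: expectation_state_action[where K=rmax] reward_bound)
qed

lemma V_bound: "\<bar>V P s\<bar> \<le> rmax / (1 - \<gamma>)"
proof -
  have "\<bar>(1 - \<gamma>) * V P s\<bar> \<le> rmax"
    unfolding V_eq by (rule abs_expectation_pmf_le) (rule mean_reward_bound)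
  then show ?thesis
    using \<gamma>_less_1 by (simp add: abs_mult field_simps)
qed

text \<open>The law \<mu> is a mixture of point masses, and \<open>discounted_state\<close> respects
  mixtures.\<close>

lemma expectation_V: "(1 - \<gamma>) * measure_pmf.expectation \<mu> (V P)
    = measure_pmf.expectation (discounted_state \<gamma> \<pi> P \<mu>) mean_reward"
proof -
  have "measure_pmf.expectation (discounted_state \<gamma> \<pi> P \<mu>) mean_reward
      = measure_pmf.expectation (discounted_state \<gamma> \<pi> P (bind_pmf \<mu> return_pmf)) mean_reward"
    by (simp add: bind_return_pmf')
  also have "\<dots> = measure_pmf.expectation \<mu> (\<lambda>s. (1 - \<gamma>) * V P s)"
    unfolding discounted_state_bind V_eq
    by (rule expectation_bind_pmf) (rule mean_reward_bound)
  finally show ?thesis by simp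
qed

text \<open>Unfolding the geometric time at a point mass separates the immediate reward from the
  discounted law after one step; \<open>expectation_V\<close> turns the latter back into a mean of
  \<open>V P\<close>, and \<open>1 - \<gamma>\<close> cancels.\<close>

lemma bellman:
  "V P s = mean_reward s
    + \<gamma> * measure_pmf.expectation (\<pi> s) (\<lambda>a. measure_pmf.expectation (P s a) (V P))"
proof -
  have "(1 - \<gamma>) * V P s = (1 - \<gamma>) * mean_reward s
      + \<gamma> * ((1 - \<gamma>) * measure_pmf.expectation (state_step \<pi> P (return_pmf s)) (V P))"
    unfolding V_eq expectation_V
    by (subst expectation_discounted_state_unfold[where K=rmax]) (auto simp: mean_reward_bound)
  also have "\<dots> = (1 - \<gamma>) * (mean_reward s
      + \<gamma> * measure_pmf.expectation (state_step \<pi> P (return_pmf s)) (V P))"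
    by (simp add: algebra_simps)
  finally have "V P s = mean_reward s
      + \<gamma> * measure_pmf.expectation (state_step \<pi> P (return_pmf s)) (V P)"
    using \<gamma>_less_1 by simp
  then show ?thesis
    by (simp add: state_step_def state_action_def bind_return_pmf bind_map_pmf
        expectation_bind_pmf[OF V_bound])
qed

text \<open>The mean of \<open>V P\<close> under the discounted state law of \<open>Q\<close> is
  computed in two ways, and the results are equated.\<close>

lemma simulation:
  "measure_pmf.expectation \<mu> (V P) - measure_pmf.expectation \<mu> (V Q)
    = \<gamma> / (1 - \<gamma>) * measure_pmf.expectation (occupancy_pmf \<gamma> \<pi> Q \<mu>)
        (\<lambda>(s, a). measure_pmf.expectation (P s a) (V P) - measure_pmf.expectation (Q s a) (V P))"
proof -
  let ?D = "discounted_state \<gamma> \<pi> Q \<mu>"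
  let ?S = "state_action \<pi> ?D"
  let ?P = "\<lambda>(s, a). measure_pmf.expectation (P s a) (V P)"
  let ?Q = "\<lambda>(s, a). measure_pmf.expectation (Q s a) (V P)"
  let ?K = "rmax / (1 - \<gamma>)"
  have bP: "\<bar>?P x\<bar> \<le> ?K" and bQ: "\<bar>?Q x\<bar> \<le> ?K" for x
    by (auto simp: split_beta intro!: abs_expectation_pmf_le V_bound)
  have bE: "\<bar>measure_pmf.expectation (\<pi> s) (\<lambda>a. ?P (s, a))\<bar> \<le> ?K" for s
    by (rule abs_expectation_pmf_le) (rule bP)
  \<comment> \<open>First evaluation: the Bellman equation of \<open>P\<close>, whose reward part
    averages under \<open>?D\<close> to the value of \<open>Q\<close>.\<close>
  have "measure_pmf.expectation ?D (V P)
      = measure_pmf.expectation ?D (\<lambda>s. mean_reward s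
          + \<gamma> * measure_pmf.expectation (\<pi> s) (\<lambda>a. ?P (s, a)))"
    by (subst bellman[abs_def]) simp
  also have "\<dots> = measure_pmf.expectation ?D mean_reward
      + measure_pmf.expectation ?D (\<lambda>s. \<gamma> * measure_pmf.expectation (\<pi> s) (\<lambda>a. ?P (s, a)))"
    by (intro Bochner_Integration.integral_add integrable_mult_right
        integrable_measure_pmf_bounded[OF mean_reward_bound] integrable_measure_pmf_bounded[OF bE])
  also have "\<dots> = (1 - \<gamma>) * measure_pmf.expectation \<mu> (V Q) + \<gamma> * measure_pmf.expectation ?S ?P"
    unfolding expectation_V expectation_state_action[where f="?P", OF bP] by simp
  finally have 1: "measure_pmf.expectation ?D (V P)
      = (1 - \<gamma>) * measure_pmf.expectation \<mu> (V Q) + \<gamma> * measure_pmf.expectation ?S ?P" .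
  \<comment> \<open>Second evaluation: the flow equation of \<open>Q\<close>, as one step after the
    geometric time amounts to starting one step later.\<close>
  have "measure_pmf.expectation ?D (V P) = (1 - \<gamma>) * measure_pmf.expectation \<mu> (V P)
      + \<gamma> * measure_pmf.expectation (state_step \<pi> Q ?D) (V P)"
    unfolding state_step_discounted_state by (rule expectation_discounted_state_unfold[OF V_bound])
  also have "measure_pmf.expectation (state_step \<pi> Q ?D) (V P) = measure_pmf.expectation ?S ?Q"
    unfolding state_step_def by (subst expectation_bind_pmf[OF V_bound]) (simp add: case_prod_unfold)
  finally have "(1 - \<gamma>) * (measure_pmf.expectation \<mu> (V P) - measure_pmf.expectation \<mu> (V Q))
      = \<gamma> * (measure_pmf.expectation ?S ?P - measure_pmf.expectation ?S ?Q)"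
    using 1 by (simp add: algebra_simps)
  also have "measure_pmf.expectation ?S ?P - measure_pmf.expectation ?S ?Q
      = measure_pmf.expectation ?S (\<lambda>x. ?P x - ?Q x)"
    by (rule Bochner_Integration.integral_diff[symmetric])
       (rule integrable_measure_pmf_bounded[OF bP] integrable_measure_pmf_bounded[OF bQ])+
  finally show ?thesis
    using \<gamma>_less_1 unfolding occupancy_pmf_def by (simp add: field_simps case_prod_unfold)
qed

end

section \<open>Comparison of target and source values through the estimated worst-case model\<close>

theorem theorem1:
  fixes \<gamma> \<sigma> rmax :: real
    and r :: "'s \<Rightarrow> 'a \<Rightarrow> real"
    and d0 :: "'s pmf"
    and Psrc Po Phat :: "('s, 'a) model"
    and sf :: 's
    and \<pi> :: "('s, 'a) policy"
    and Pw Pbar :: "('s, 'a) model"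
  assumes "0 < \<gamma>" and "\<gamma> < 1"
    and "\<forall>s a. \<bar>r s a\<bar> \<le> rmax"
    and "fail_state r Po sf"
    and "worst_case_model \<gamma> r \<pi> (tv_ball \<sigma> Po) Pw"
    and "worst_case_model \<gamma> r \<pi> (tv_ball \<sigma> Phat) Pbar"
  defines "A \<equiv> \<lambda>s a. tv_dist (Pw s a) (Pbar s a)"
    and "B \<equiv> \<lambda>s a.
      \<bar>measure_pmf.expectation (Psrc s a) (robust_V \<gamma> r \<pi> (tv_ball \<sigma> Phat))
        - (INF P\<in>tv_ball \<sigma> Phat.
             measure_pmf.expectation (P s a) (robust_V \<gamma> r \<pi> (tv_ball \<sigma> Phat)))\<bar>"
  shows "measure_pmf.expectation d0 (robust_V \<gamma> r \<pi> (tv_ball \<sigma> Po))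
    \<ge> measure_pmf.expectation d0 (V_fun \<gamma> r \<pi> Psrc)
      - 2 * \<gamma> * rmax / (1 - \<gamma>)\<^sup>2 * occ_expectation (occupancy \<gamma> d0 \<pi> Pbar) A
      - \<gamma> / (1 - \<gamma>) * occ_expectation (occupancy \<gamma> d0 \<pi> Psrc) B"
proof -
  interpret bounded_reward \<gamma> r rmax \<pi>
    using assms(1-3) by unfold_locales auto
  let ?K = "rmax / (1 - \<gamma>)"
  let ?U = "tv_ball \<sigma> Phat"
  \<comment> \<open>A worst-case model attains the infimum at every state simultaneously, so each
    robust value function is the value function of a single model and \<open>simulation\<close>
    applies.\<close>
  have Vw: "robust_V \<gamma> r \<pi> (tv_ball \<sigma> Po) = V Pw"
    and Vbar: "robust_V \<gamma> r \<pi> ?U = V Pbar" and Pbar: "Pbar \<in> ?U"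
    using assms(5,6) by (auto simp: worst_case_model_def)
  have E_bound: "\<bar>measure_pmf.expectation p (V P)\<bar> \<le> ?K" for p P
    by (rule abs_expectation_pmf_le) (rule V_bound)
  let ?inf = "\<lambda>s a. INF P\<in>?U. measure_pmf.expectation (P s a) (V Pbar)"
  have lower: "- ?K \<le> measure_pmf.expectation p (V P)" for p P
    using E_bound[of p P] by linarith
  \<comment> \<open>\<open>Pbar\<close> competes in the infimum; the uniform lower bound
    \<open>- ?K\<close> ensures that the real infimum is a genuine lower bound.\<close>
  have inf_le: "?inf s a \<le> measure_pmf.expectation (Pbar s a) (V Pbar)" for s a
    using Pbar lower by (intro cINF_lower bdd_belowI2) auto
  moreover have "- ?K \<le> ?inf s a" for s a
    using Pbar lower by (intro cINF_greatest) auto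
  ultimately have inf_bound: "\<bar>?inf s a\<bar> \<le> ?K" for s a
    using E_bound[of "Pbar s a" Pbar] by (meson abs_le_iff minus_le_iff order_trans)
  have B_eq: "B s a = \<bar>measure_pmf.expectation (Psrc s a) (V Pbar) - ?inf s a\<bar>" for s a
    unfolding B_def Vbar by simp
  have B_bound: "\<bar>B s a\<bar> \<le> 2 * ?K" for s a
    unfolding B_eq using inf_bound[of s a] E_bound[of "Psrc s a" Pbar] by linarith
  have A_bound: "\<bar>A s a\<bar> \<le> 1" for s a
    unfolding A_def using tv_dist_le_1[of "Pw s a" "Pbar s a"] tv_dist_nonneg[of "Pw s a" "Pbar s a"] by simp
  have diff_bound: "\<bar>measure_pmf.expectation p (V P) - measure_pmf.expectation q (V P)\<bar> \<le> 2 * ?K" for p q P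
    using E_bound[of p P] E_bound[of q P] by linarith
  have coeff: "0 \<le> \<gamma> / (1 - \<gamma>)"
    using assms(1,2) by simp

  let ?dbar = "occupancy_pmf \<gamma> \<pi> Pbar d0" and ?dsrc = "occupancy_pmf \<gamma> \<pi> Psrc d0"
  \<comment> \<open>\<open>simulation\<close> will be used with \<open>Pw\<close> and
    \<open>Pbar\<close>, hence the occupancy of \<open>Pbar\<close>. The factor
    \<open>2 * ?K\<close>, times \<open>\<gamma> / (1 - \<gamma>)\<close>, yields the coefficient of
    the \<open>A\<close> term.\<close>
  have "measure_pmf.expectation ?dbar (\<lambda>(s, a). - (2 * ?K * A s a))
      \<le> measure_pmf.expectation ?dbar (\<lambda>(s, a).
          measure_pmf.expectation (Pw s a) (V Pw) - measure_pmf.expectation (Pbar s a) (V Pw))"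
  proof (intro integral_mono)
    show "integrable ?dbar (\<lambda>(s, a). - (2 * ?K * A s a))"
    proof (rule integrable_measure_pmf_bounded[where K="\<bar>2 * ?K\<bar>"])
      show "\<bar>case x of (s, a) \<Rightarrow> - (2 * ?K * A s a)\<bar> \<le> \<bar>2 * ?K\<bar>" for x
        using mult_left_mono[OF A_bound abs_ge_zero, of "2 * ?K" "fst x" "snd x"]
        unfolding split_beta abs_minus_cancel abs_mult[of "2 * ?K"] by simp
    qed
    show "integrable ?dbar (\<lambda>(s, a).
        measure_pmf.expectation (Pw s a) (V Pw) - measure_pmf.expectation (Pbar s a) (V Pw))"
      using diff_bound by (intro integrable_measure_pmf_bounded[where K="2 * ?K"]) (auto simp: split_beta)
    show "(case x of (s, a) \<Rightarrow> - (2 * ?K * A s a)) \<le> (case x of (s, a) \<Rightarrow>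
        measure_pmf.expectation (Pw s a) (V Pw) - measure_pmf.expectation (Pbar s a) (V Pw))" for x
      using expectation_diff_le_tv_dist[where f="V Pw" and K="?K", OF V_bound,
          of "Pw (fst x) (snd x)" "Pbar (fst x) (snd x)"]
      unfolding A_def split_beta by linarith
  qed
  then have "\<gamma> / (1 - \<gamma>) * measure_pmf.expectation ?dbar (\<lambda>(s, a). - (2 * ?K * A s a))
      \<le> measure_pmf.expectation d0 (V Pw) - measure_pmf.expectation d0 (V Pbar)"
    unfolding simulation using coeff by (rule mult_left_mono)
  also have "measure_pmf.expectation ?dbar (\<lambda>(s, a). - (2 * ?K * A s a))
      = - (2 * ?K * occ_expectation (occupancy \<gamma> d0 \<pi> Pbar) A)"
    unfolding occ_expectation_eq[OF A_bound] by (simp add: case_prod_unfold)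
  finally have 1: "- (2 * \<gamma> * rmax / (1 - \<gamma>)\<^sup>2 * occ_expectation (occupancy \<gamma> d0 \<pi> Pbar) A)
      \<le> measure_pmf.expectation d0 (V Pw) - measure_pmf.expectation d0 (V Pbar)"
    by (simp add: power2_eq_square mult_ac)

  \<comment> \<open>Now the pair is \<open>Pbar\<close> and \<open>Psrc\<close>. Pointwise,
    \<open>- B\<close> is at most the infimum minus the source expectation, and
    \<open>inf_le\<close> replaces the infimum by the expectation under \<open>Pbar\<close>.\<close>
  have "measure_pmf.expectation ?dsrc (\<lambda>(s, a). - B s a)
      \<le> measure_pmf.expectation ?dsrc (\<lambda>(s, a).
          measure_pmf.expectation (Pbar s a) (V Pbar) - measure_pmf.expectation (Psrc s a) (V Pbar))"
  proof (intro integral_mono)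
    show "integrable ?dsrc (\<lambda>(s, a). - B s a)"
      using B_bound by (intro integrable_measure_pmf_bounded[where K="2 * ?K"]) (auto simp: split_beta)
    show "integrable ?dsrc (\<lambda>(s, a).
        measure_pmf.expectation (Pbar s a) (V Pbar) - measure_pmf.expectation (Psrc s a) (V Pbar))"
      using diff_bound by (intro integrable_measure_pmf_bounded[where K="2 * ?K"]) (auto simp: split_beta)
    show "(case x of (s, a) \<Rightarrow> - B s a) \<le> (case x of (s, a) \<Rightarrow>
        measure_pmf.expectation (Pbar s a) (V Pbar) - measure_pmf.expectation (Psrc s a) (V Pbar))" for x
      using inf_le[of "fst x" "snd x"] unfolding B_eq split_beta by linarith
  qed
  then have "\<gamma> / (1 - \<gamma>) * measure_pmf.expectation ?dsrc (\<lambda>(s, a). - B s a)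
      \<le> measure_pmf.expectation d0 (V Pbar) - measure_pmf.expectation d0 (V Psrc)"
    unfolding simulation using coeff by (rule mult_left_mono)
  also have "measure_pmf.expectation ?dsrc (\<lambda>(s, a). - B s a)
      = - occ_expectation (occupancy \<gamma> d0 \<pi> Psrc) B"
    unfolding occ_expectation_eq[OF B_bound] by (simp add: case_prod_unfold)
  finally have 2: "- (\<gamma> / (1 - \<gamma>) * occ_expectation (occupancy \<gamma> d0 \<pi> Psrc) B)
      \<le> measure_pmf.expectation d0 (V Pbar) - measure_pmf.expectation d0 (V Psrc)"
    by simp
  \<comment> \<open>Adding the two bounds cancels the value of \<open>Pbar\<close>.\<close>
  show ?thesis
    unfolding Vw using 1 2 by linarith
qed

end
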